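(* Suppose that $\boldsymbol{x}\sim AG_d(\boldsymbol{\mu},\boldsymbol{\Sigma})$ (Angular Gaussian distribution), with $\boldsymbol{x}=[\boldsymbol{x}_1^T,\boldsymbol{x}_2^T]^T\in\mathbb{R}^d$, $\boldsymbol{x}_1\in\mathbb{R}^{d_1}$, $\boldsymbol{x}_2\in\mathbb{R}^{d_2}$ and $d=d_1+d_2$, and partition $\boldsymbol{\mu}=[\boldsymbol{\mu}_1^T,\boldsymbol{\mu}_2^T]^T$ and $\boldsymbol{\Sigma}=\begin{pmatrix}\boldsymbol{\Sigma}_{11}&\boldsymbol{\Sigma}_{12}\\ \boldsymbol{\Sigma}_{21}&\boldsymbol{\Sigma}_{22}\end{pmatrix}$ accordingly. Then $$\boldsymbol{x}_2\mid\boldsymbol{x}_1\sim t_\nu(\boldsymbol{\mu}_{2.1},\boldsymbol{\Sigma}_{22.1}),$$ where $t_\nu(\boldsymbol{\mu}_{2.1},\boldsymbol{\Sigma}_{22.1})$ is a multivariate $t$-distribution with $\nu=d_1$ degrees of freedom, mean vector $$\boldsymbol{\mu}_{2.1}=\boldsymbol{\mu}_2+\boldsymbol{\Sigma}_{21}\boldsymbol{\Sigma}_{11}^{-1}(\boldsymbol{x}_1-\boldsymbol{\mu}_1)$$ and scale matrix $$\boldsymbol{\Sigma}_{22.1}=s_{22.1}\big(\boldsymbol{\Sigma}_{22}-\boldsymbol{\Sigma}_{21}\boldsymbol{\Sigma}_{11}^{-1}\boldsymbol{\Sigma}_{12}\big),\qquad s_{22.1}=\frac{1}{d_1}(\bo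ldsymbol{x}_1-\boldsymbol{\mu}_1)^T\boldsymbol{\Sigma}_{11}^{-1}(\boldsymbol{x}_1-\boldsymbol{\mu}_1)\in\mathbb{R}.$$
   Context: The Angular Gaussian distribution $AG_d(\boldsymbol{\mu},\boldsymbol{\Sigma})$, with $\boldsymbol{\mu}\in\mathbb{R}^d$ and $\boldsymbol{\Sigma}$ a $d\times d$ scatter matrix, is the distribution with probability density function $$f_{AG}(\boldsymbol{x})=B\det(\boldsymbol{\Sigma})^{-1/2}\big[(\boldsymbol{x}-\boldsymbol{\mu})^T\boldsymbol{\Sigma}^{-1}(\boldsymbol{x}-\boldsymbol{\mu})\big]^{-d/2},$$ where $B$ is a normalization constant. The conditional density of $\boldsymbol{x}_2$ given $\boldsymbol{x}_1$ is $f(\boldsymbol{x}_2\mid\boldsymbol{x}_1)=f(\boldsymbol{x}_1,\boldsymbol{x}_2)/f(\boldsymbol{x}_1)$, where $f(\boldsymbol{x}_1,\boldsymbol{x}_2)$ is the $AG_d(\boldsymbol{\mu},\boldsymbol{\Sigma})$ density and $f(\boldsymbol{x}_1)$ is taken proportional to $\det(\boldsymbol{\Sigma}_{11})^{-1/2}\big[(\boldsymbol{x}_1-\boldsymbol{\mu}_1)^T\boldsymbol{\Sigma}_{11}^{-1}(\boldsymbol{x}_1-\boldsymbol{\mu}_1)\big]^{-d_1/2}$. The multivariate $t$-distribution $t_\nu(\boldsymbol{a},\boldsymbol{S})$ on $\mathbb{R}^{d_2}$ with $\nu$ degrees of freedom, mean vector $\boldsymbol{a}$ and scale matrix $\boldsymbol{S}$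 has density proportional, as a function of $\boldsymbol{y}$, to $$\Big[1+\tfrac1\nu(\boldsymbol{y}-\boldsymbol{a})^T\boldsymbol{S}^{-1}(\boldsymbol{y}-\boldsymbol{a})\Big]^{-(\nu+d_2)/2}.$$ *)

theory Defs
  imports "HOL-Probability.Probability"
begin

text \<open>
  The partitioned space \<open>\<real>\<^bsup>d\<^sub>1 + d\<^sub>2\<^esup>\<close> is rendered as \<open>real ^ ('m + 'n)\<close>: the index type is the
  disjoint sum, \<open>Inl\<close> selects the first block of coordinates and \<open>Inr\<close> the second.
\<close>

definition subvec :: "('i \<Rightarrow> 'd) \<Rightarrow> real ^ 'd::finite \<Rightarrow> real ^ 'i::finite" where
  "subvec r v = (\<chi> i. v $ r i)"

definition submat ::
  "('i \<Rightarrow> 'r) \<Rightarrow> ('j \<Rightarrow> 'c) \<Rightarrow> real ^ 'c::finite ^ 'r::finite \<Rightarrow> real ^ 'j::finite ^ 'i::finite"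
  where "submat r c A = (\<chi> i j. A $ r i $ c j)"

definition join_vec ::
  "real ^ 'm::finite \<Rightarrow> real ^ 'n::finite \<Rightarrow> real ^ ('m + 'n)" where
  "join_vec x1 x2 = (\<chi> k. case k of Inl i \<Rightarrow> x1 $ i | Inr j \<Rightarrow> x2 $ j)"

definition scatter_matrix :: "real ^ 'd::finite ^ 'd \<Rightarrow> bool" where
  "scatter_matrix A \<longleftrightarrow> transpose A = A \<and> (\<forall>v. v \<noteq> 0 \<longrightarrow> 0 < v \<bullet> (A *v v))"

definition quad_inv :: "real ^ 'd::finite ^ 'd \<Rightarrow> real ^ 'd \<Rightarrow> real" where
  "quad_inv A v = v \<bullet> (matrix_inv A *v v)"

text \<open>
  The function below is not Lebesgue integrable on the whole space when \<open>B > 0\<close>, so no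
  random vector has it as its Lebesgue density; it is used as an (improper) density function,
  with the constant \<open>B\<close> as a parameter. Its value at \<open>x = \<mu>\<close>, where the formula is
  undefined, is \<open>0\<close>.
\<close>

definition ag_density ::
  "real \<Rightarrow> real ^ 'd::finite \<Rightarrow> real ^ 'd ^ 'd \<Rightarrow> real ^ 'd \<Rightarrow> real" where
  "ag_density B \<mu> \<Sigma> x =
     B * det \<Sigma> powr (- 1 / 2) * quad_inv \<Sigma> (x - \<mu>) powr (- real CARD('d) / 2)"

text \<open>
  The constant \<open>B\<close> belongs to the joint density and \<open>C\<close> to the density of the first block.
\<close>

definition ag_cond_density ::
  "real \<Rightarrow> real \<Rightarrow> real ^ ('m::finite + 'n::finite) \<Rightarrow> real ^ ('m + 'n) ^ ('m + 'n) \<Rightarrow>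
   real ^ 'm \<Rightarrow> real ^ 'n \<Rightarrow> real" where
  "ag_cond_density B C \<mu> \<Sigma> x1 x2 =
     ag_density B \<mu> \<Sigma> (join_vec x1 x2) /
     ag_density C (subvec Inl \<mu>) (submat Inl Inl \<Sigma>) x1"

definition mvt_kernel ::
  "real \<Rightarrow> real ^ 'n::finite \<Rightarrow> real ^ 'n ^ 'n \<Rightarrow> real ^ 'n \<Rightarrow> real" where
  "mvt_kernel \<nu> a S y =
     (1 + 1 / \<nu> * quad_inv S (y - a)) powr (- (\<nu> + real CARD('n)) / 2)"

text \<open>
  Being a probability density forces the proportionality constant to be the normalizing one, so
  \<open>f\<close> is determined by \<open>\<nu>\<close>, \<open>a\<close> and \<open>S\<close>.
\<close>

definition is_mvt_density ::
  "real \<Rightarrow> real ^ 'n::finite \<Rightarrow> real ^ 'n ^ 'n \<Rightarrow> (real ^ 'n \<Rightarrow> real) \<Rightarrow> bool" where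
  "is_mvt_density \<nu> a S f \<longleftrightarrow>
     0 < \<nu> \<and> scatter_matrix S \<and>
     prob_space (density lborel (\<lambda>y. ennreal (f y))) \<and>
     (\<exists>c>0. \<forall>y. f y = c * mvt_kernel \<nu> a S y)"

definition cond_mean ::
  "real ^ ('m::finite + 'n::finite) \<Rightarrow> real ^ ('m + 'n) ^ ('m + 'n) \<Rightarrow> real ^ 'm \<Rightarrow> real ^ 'n"
  where
  "cond_mean \<mu> \<Sigma> x1 =
     subvec Inr \<mu> +
     (submat Inr Inl \<Sigma> ** matrix_inv (submat Inl Inl \<Sigma>)) *v (x1 - subvec Inl \<mu>)"

definition cond_scale_factor ::
  "real ^ ('m::finite + 'n::finite) \<Rightarrow> real ^ ('m + 'n) ^ ('m + 'n) \<Rightarrow> real ^ 'm \<Rightarrow> real" where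
  "cond_scale_factor \<mu> \<Sigma> x1 =
     1 / real CARD('m) * quad_inv (submat Inl Inl \<Sigma>) (x1 - subvec Inl \<mu>)"

definition cond_scale ::
  "real ^ ('m::finite + 'n::finite) \<Rightarrow> real ^ ('m + 'n) ^ ('m + 'n) \<Rightarrow> real ^ 'm \<Rightarrow>
   real ^ 'n ^ 'n" where
  "cond_scale \<mu> \<Sigma> x1 =
     cond_scale_factor \<mu> \<Sigma> x1 *\<^sub>R
     (submat Inr Inr \<Sigma> -
      submat Inr Inl \<Sigma> ** matrix_inv (submat Inl Inl \<Sigma>) ** submat Inl Inr \<Sigma>)"

end

theory Submission
  imports Defs
begin

text \<open>
  Block elimination writes \<open>\<Sigma> = U D U\<^sup>T\<close> with \<open>U\<close> unipotent and \<open>D\<close> block diagonal with blocks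
  \<open>\<Sigma>\<^sub>1\<^sub>1\<close> and the Schur complement \<open>S\<close>, so \<open>det \<Sigma> = det \<Sigma>\<^sub>1\<^sub>1 det S\<close> and the quadratic form of the joint
  density is \<open>q + (x\<^sub>2 - \<mu>\<^sub>2\<^sub>.\<^sub>1)\<^sup>T S\<^sup>-\<^sup>1 (x\<^sub>2 - \<mu>\<^sub>2\<^sub>.\<^sub>1)\<close>, where \<open>q\<close> is the quadratic form of the first block.
  Pulling out \<open>q\<close> turns the quotient of densities into the \<open>t\<close> kernel with scale matrix
  \<open>q S / d\<^sub>1\<close>. A factorization \<open>q S = L L\<^sup>T\<close> and the substitution \<open>x\<^sub>2 = \<mu>\<^sub>2\<^sub>.\<^sub>1 + L z\<close> show that its total mass
  is \<open>B / C\<close> times \<open>\<integral> (1 + |z|\<^sup>2) powr (- d / 2) dz\<close>, a finite number that depends on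
  the dimensions only; this determines \<open>C\<close>.
\<close>

subsection \<open>Block matrices\<close>

text \<open>Padding by the identity outside \<open>range r\<close>, for a general index map, so that
  one determinant lemma serves both \<open>Inl\<close> and \<open>Inr\<close>. It is meant for
  injective \<open>r\<close>, where \<open>inv r\<close> recovers the original index.\<close>

definition embed_matrix :: "('i \<Rightarrow> 'd) \<Rightarrow> real ^ 'i::finite ^ 'i \<Rightarrow> real ^ 'd::finite ^ 'd" where
  "embed_matrix r A = (\<chi> k l. if k \<in> range r \<and> l \<in> range r then A $ inv r k $ inv r l
                               else of_bool (k = l))"

lemma embed_matrix_range [simp]:
  "inj r \<Longrightarrow> embed_matrix r A $ r i $ r j = A $ i $ j"
  by (simp add: embed_matrix_def)

lemma embed_matrix_outside:
  "k \<notin> range r \<or> l \<notin> range r \<Longrightarrow> embed_matrix r A $ k $ l = of_bool (k = l)"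
  by (auto simp: embed_matrix_def)

text \<open>Between indices in \<open>range r\<close> the inner sum receives nothing from the other
  indices; elsewhere one factor contributes a row or column of the identity.\<close>

lemma embed_matrix_mult:
  assumes "inj r"
  shows "embed_matrix r (A ** B) = embed_matrix r A ** embed_matrix r B"
proof -
  have split: "(\<Sum>p\<in>UNIV. g p) = (\<Sum>i\<in>UNIV. g (r i)) + (\<Sum>p\<in>- range r. g p)"
    for g :: "'b \<Rightarrow> real"
  proof -
    have "sum g UNIV = sum g (range r) + sum g (- range r)"
      by (metis Compl_disjoint finite sum.union_disjoint sup_compl_top)
    then show ?thesis
      by (simp add: sum.reindex[OF assms])
  qed
  have "embed_matrix r (A ** B) $ k $ l = (embed_matrix r A ** embed_matrix r B) $ k $ l" for k l
  proof (cases "k \<in> range r \<and> l \<in> range r")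
    case True
    then obtain i j where ij: "k = r i" "l = r j" by blast
    have "(\<Sum>p\<in>- range r. embed_matrix r A $ r i $ p * embed_matrix r B $ p $ r j) = 0"
      by (intro sum.neutral) (auto simp: embed_matrix_outside)
    then show ?thesis
      by (simp add: ij assms matrix_matrix_mult_def split)
  next
    case False
    have "(embed_matrix r A ** embed_matrix r B) $ k $ l
          = (\<Sum>p\<in>UNIV. embed_matrix r A $ k $ p * embed_matrix r B $ p $ l)"
      by (simp add: matrix_matrix_mult_def)
    also have "\<dots> = of_bool (k = l)"
    proof (cases "k \<in> range r")
      case True
      then have "l \<notin> range r" "k \<noteq> l" using False by auto
      then show ?thesis by (simp add: embed_matrix_outside)
    next
      case False
      then show ?thesis by (simp add: embed_matrix_outside)
    qed
    finally show ?thesis using False by (simp add: embed_matrix_outside)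
  qed
  then show ?thesis by (simp add: vec_eq_iff)
qed

lemma det_mat: "det (mat c :: real ^ 'd::finite ^ 'd) = c ^ CARD('d)"
proof -
  have "det (mat c :: real ^ 'd ^ 'd) = (\<Prod>i\<in>UNIV. (mat c :: real ^ 'd ^ 'd) $ i $ i)"
    by (rule det_diagonal) (simp add: mat_def)
  then show ?thesis by (simp add: mat_def)
qed

lemma det_swap_matrix:
  fixes m n :: "'d::finite"
  assumes "m \<noteq> n"
  shows "det ((\<chi> i j. mat 1 $ i $ Transposition.transpose m n j) :: real^'d^'d) = -1"
proof -
  have "det ((\<chi> i j. mat 1 $ i $ Transposition.transpose m n j) :: real^'d^'d)
      = of_int (sign (Transposition.transpose m n)) * det (mat 1 :: real^'d^'d)"
    by (intro det_permute_columns) (simp add: permutes_swap_id)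
  then show ?thesis using assms by (simp add: sign_swap_id)
qed

lemma det_shear_matrix:
  fixes m n :: "'d::finite"
  assumes "m \<noteq> n"
  shows "det ((\<chi> i j. if i = m \<and> j = n then c else of_bool (i = j)) :: real^'d^'d) = 1"
proof -
  have "((\<chi> i j. if i = m \<and> j = n then c else of_bool (i = j)) :: real^'d^'d)
     = (\<chi> k. if k = m then row m (mat 1) + c *s row n (mat 1) else row k (mat 1 :: real^'d^'d))"
    using assms by (auto simp: vec_eq_iff row_def mat_def)
  then show ?thesis
    using det_row_operation[OF assms, of "mat 1 :: real^'d^'d" c] by simp
qed

text \<open>Both sides are multiplicative, so induction over elementary factors applies: a matrix
  with a zero row, a diagonal matrix, a swap and a shear each embed as a matrix of the same
  kind.\<close>

lemma det_embed_matrix: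
  assumes r: "inj r"
  shows "det (embed_matrix r A) = det A"
proof (induction A rule: induct_matrix_elementary)
  case (1 A B)
  then show ?case by (simp add: embed_matrix_mult[OF r] det_mul)
next
  case (2 A i)
  have "row (r i) (embed_matrix r A) $ l = 0" for l
  proof (cases "l \<in> range r")
    case True
    then show ?thesis using 2 by (auto simp: row_def r vec_eq_iff)
  next
    case False
    then show ?thesis by (auto simp: row_def embed_matrix_outside)
  qed
  then have "row (r i) (embed_matrix r A) = 0" by (simp add: vec_eq_iff)
  then show ?case using 2 det_zero_row by metis
next
  case (3 A)
  have "embed_matrix r A $ k $ l = 0" if "k \<noteq> l" for k l
  proof (cases "k \<in> range r \<and> l \<in> range r")
    case True
    then obtain i j where "k = r i" "l = r j" by blast
    with that 3 show ?thesis using r by (metis embed_matrix_range)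
  qed (use that in \<open>auto simp: embed_matrix_outside\<close>)
  then have "det (embed_matrix r A) = (\<Prod>k\<in>UNIV. embed_matrix r A $ k $ k)"
    by (rule det_diagonal)
  also have "\<dots> = (\<Prod>k\<in>range r. embed_matrix r A $ k $ k)"
    by (rule prod.mono_neutral_right) (auto simp: embed_matrix_outside)
  also have "\<dots> = det A"
    using 3 by (simp add: prod.reindex r det_diagonal)
  finally show ?case .
next
  case (4 m n)
  have "embed_matrix r (\<chi> i j. mat 1 $ i $ Transposition.transpose m n j)
      = (\<chi> k l. mat 1 $ k $ Transposition.transpose (r m) (r n) l)"
  proof -
    have "embed_matrix r (\<chi> i j. mat 1 $ i $ Transposition.transpose m n j) $ k $ l
        = (\<chi> k l. mat 1 $ k $ Transposition.transpose (r m) (r n) l) $ k $ l" for k l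
    proof (cases "k \<in> range r \<and> l \<in> range r")
      case True
      then show ?thesis
        by (auto simp: r mat_def Transposition.transpose_def inj_eq[OF r])
    next
      case False
      then show ?thesis
        by (auto simp: embed_matrix_outside mat_def Transposition.transpose_def)
    qed
    then show ?thesis by (simp add: vec_eq_iff)
  qed
  then show ?case using 4 r by (simp add: det_swap_matrix inj_eq)
next
  case (5 m n c)
  have "embed_matrix r (\<chi> i j. if i = m \<and> j = n then c else of_bool (i = j))
      = (\<chi> k l. if k = r m \<and> l = r n then c else of_bool (k = l))"
  proof -
    have "embed_matrix r (\<chi> i j. if i = m \<and> j = n then c else of_bool (i = j)) $ k $ l
        = (\<chi> k l. if k = r m \<and> l = r n then c else of_bool (k = l)) $ k $ l" for k l
    proof (cases "k \<in> range r \<and> l \<in> range r")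
      case True
      then show ?thesis by (auto simp: r inj_eq[OF r])
    next
      case False
      then show ?thesis by (auto simp: embed_matrix_outside)
    qed
    then show ?thesis by (simp add: vec_eq_iff)
  qed
  then show ?case using 5 r by (simp add: det_shear_matrix inj_eq)
qed

section \<open>Two-by-two block matrices indexed by a sum type\<close>

definition block_matrix ::
  "real ^ 'm::finite ^ 'm \<Rightarrow> real ^ 'n::finite ^ 'm \<Rightarrow> real ^ 'm ^ 'n \<Rightarrow> real ^ 'n ^ 'n \<Rightarrow>
   real ^ ('m + 'n) ^ ('m + 'n)" where
  "block_matrix A B C D =
     (\<chi> k l. case k of
        Inl i \<Rightarrow> (case l of Inl j \<Rightarrow> A $ i $ j | Inr j \<Rightarrow> B $ i $ j)
      | Inr i \<Rightarrow> (case l of Inl j \<Rightarrow> C $ i $ j | Inr j \<Rightarrow> D $ i $ j))"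

lemma sum_UNIV_Plus:
  "(\<Sum>k\<in>(UNIV :: ('m::finite + 'n::finite) set). g k) = (\<Sum>i\<in>UNIV. g (Inl i)) + (\<Sum>j\<in>UNIV. g (Inr j))"
  by (simp add: UNIV_Plus_UNIV[symmetric] sum.Plus o_def del: UNIV_Plus_UNIV)

lemma block_matrix_mult:
  "block_matrix A B C D ** block_matrix A' B' C' D' =
   block_matrix (A ** A' + B ** C') (A ** B' + B ** D') (C ** A' + D ** C') (C ** B' + D ** D')"
  by (auto simp: vec_eq_iff block_matrix_def matrix_matrix_mult_def sum_UNIV_Plus split: sum.split)

lemma block_matrix_vector_mult:
  "block_matrix A B C D *v join_vec u v = join_vec (A *v u + B *v v) (C *v u + D *v v)"
  by (auto simp: vec_eq_iff block_matrix_def join_vec_def matrix_vector_mult_def sum_UNIV_Plus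
      split: sum.split)

lemma transpose_block_matrix:
  "transpose (block_matrix A B C D) =
   block_matrix (transpose A) (transpose C) (transpose B) (transpose D)"
  by (auto simp: vec_eq_iff block_matrix_def transpose_def split: sum.split)

lemma block_matrix_submat:
  "block_matrix (submat Inl Inl A) (submat Inl Inr A) (submat Inr Inl A) (submat Inr Inr A) = A"
  by (auto simp: vec_eq_iff block_matrix_def submat_def split: sum.split)

lemma block_matrix_one: "block_matrix (mat 1) 0 0 (mat 1) = mat 1"
  by (auto simp: vec_eq_iff block_matrix_def mat_def split: sum.split)

lemma block_matrix_eq_iff:
  "block_matrix A B C D = block_matrix A' B' C' D' \<longleftrightarrow> A = A' \<and> B = B' \<and> C = C' \<and> D = D'"
proof
  assume *: "block_matrix A B C D = block_matrix A' B' C' D'"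
  have "block_matrix A B C D $ k $ l = block_matrix A' B' C' D' $ k $ l" for k l
    by (simp add: *)
  from this[of "Inl _" "Inl _"] this[of "Inl _" "Inr _"] this[of "Inr _" "Inl _"]
    this[of "Inr _" "Inr _"]
  show "A = A' \<and> B = B' \<and> C = C' \<and> D = D'"
    by (simp add: block_matrix_def vec_eq_iff)
qed simp

lemma inner_join_vec: "join_vec u v \<bullet> join_vec u' v' = u \<bullet> u' + v \<bullet> v'"
  by (simp add: inner_vec_def sum_UNIV_Plus join_vec_def)

lemma join_vec_subvec: "join_vec (subvec Inl v) (subvec Inr v) = v"
  by (auto simp: vec_eq_iff join_vec_def subvec_def split: sum.split)

lemma join_vec_diff: "join_vec u v - join_vec u' v' = join_vec (u - u') (v - v')"
  by (auto simp: vec_eq_iff join_vec_def split: sum.split)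

lemma join_vec_eq_0_iff: "join_vec u v = 0 \<longleftrightarrow> u = 0 \<and> v = 0"
proof -
  have "join_vec u v = 0 \<longleftrightarrow> (\<forall>i. join_vec u v $ Inl i = 0) \<and> (\<forall>j. join_vec u v $ Inr j = 0)"
    by (metis sum.exhaust vec_eq_iff zero_index)
  then show ?thesis by (simp add: join_vec_def vec_eq_iff)
qed

text \<open>The matrix is a product of two block diagonal matrices with one identity block each, and
  these are embeddings along \<open>Inl\<close> and \<open>Inr\<close>.\<close>

lemma det_block_diagonal:
  "det (block_matrix A 0 0 D) = det A * det (D :: real ^ 'n::finite ^ 'n)"
proof -
  have "block_matrix A 0 0 D = block_matrix A 0 0 (mat 1) ** block_matrix (mat 1) 0 0 D"
    by (simp add: block_matrix_mult)
  moreover have "block_matrix A 0 0 (mat 1) = embed_matrix Inl A"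
    by (auto simp: vec_eq_iff block_matrix_def embed_matrix_def mat_def split: sum.split)
  moreover have "block_matrix (mat 1) 0 0 D = embed_matrix Inr D"
    by (auto simp: vec_eq_iff block_matrix_def embed_matrix_def mat_def split: sum.split)
  ultimately show ?thesis by (metis det_embed_matrix det_mul inj_Inl inj_Inr)
qed

text \<open>
  Conjugation by \<open>diag(1, 2)\<close> doubles the off-diagonal block and hence squares the matrix, so the
  determinant is idempotent; it is nonzero because \<open>- X\<close> gives the inverse matrix.
\<close>

lemma det_block_unipotent: "det (block_matrix (mat 1) 0 X (mat 1)) = 1"
proof -
  let ?U = "\<lambda>X. block_matrix (mat 1) 0 X (mat 1)"
  let ?D = "block_matrix (mat 1) 0 0 (mat 2 :: real^'b^'b)"
  have scale: "(mat 2 :: real^'b^'b) ** X = X + X" for X :: "real^'a^'b"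
    by (simp add: vec_eq_iff matrix_matrix_mult_def mat_def if_distrib[of "\<lambda>x. x * y" for y] cong: if_cong)
  have "?D ** ?U X = ?U (X + X) ** ?D"
    by (simp add: block_matrix_mult scale block_matrix_eq_iff)
  then have "det (?D ** ?U X) = det (?U (X + X) ** ?D)" by (rule arg_cong)
  moreover have "det ?D \<noteq> 0"
    by (simp only: det_block_diagonal det_mat) simp
  ultimately have *: "det (?U X) = det (?U (X + X))"
    unfolding det_mul by (simp only: mult.commute[of "det ?D"] mult_cancel_right) blast
  have "?U (X + X) = ?U X ** ?U X" by (simp add: block_matrix_mult)
  then have "det (?U (X + X)) = det (?U X) * det (?U X)" by (simp only: det_mul)
  with * have "det (?U X) = 0 \<or> det (?U X) = 1" by (simp only: mult_cancel_right1)
  moreover have "?U X ** ?U (- X) = mat 1"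
    by (simp add: block_matrix_mult block_matrix_one)
  then have "det (?U X ** ?U (- X)) = 1" by (simp only: det_I)
  then have "det (?U X) * det (?U (- X)) = 1" by (simp only: det_mul)
  ultimately show ?thesis by auto
qed

subsection \<open>Scatter matrices and Schur complements\<close>

lemma matrix_inv_mult:
  assumes "invertible A"
  shows "A ** matrix_inv A = mat 1" and "matrix_inv A ** A = mat 1"
  using someI_ex[OF assms[unfolded invertible_def]] by (auto simp: matrix_inv_def)

text \<open>Any solution \<open>w\<close> of the linear system may stand in for the inverse applied
  to \<open>v\<close>; later evaluations of quadratic forms exhibit such a \<open>w\<close>.\<close>

lemma quad_inv_eqI:
  assumes "invertible A" "A *v w = v"
  shows "quad_inv A v = v \<bullet> w"
  using matrix_inv_mult(2)[OF assms(1)] assms(2)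
  by (metis matrix_vector_mul_assoc matrix_vector_mul_lid quad_inv_def)

lemma inner_matrix_vector_transpose:
  fixes M :: "real ^ 'a::finite ^ 'b::finite"
  shows "(M *v x) \<bullet> y = x \<bullet> (transpose M *v y)"
  by (metis dot_lmul_matrix transpose_matrix_vector transpose_transpose)

lemma invertible_transpose: "invertible (A :: real ^ 'a::finite ^ 'a) \<Longrightarrow> invertible (transpose A)"
  by (simp add: invertible_det_nz)

text \<open>The inverse of \<open>M ** A ** transpose M\<close> sends \<open>M *v u\<close> to the
  inverse of \<open>transpose M\<close> applied to \<open>matrix_inv A *v u\<close>, and pairing
  with \<open>M *v u\<close> cancels \<open>M\<close>. This serves both the block elimination and
  the substitution by a factor of the scale matrix.\<close>

lemma quad_inv_congruence:
  fixes M A :: "real ^ 'd::finite ^ 'd"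
  assumes M: "invertible M" and A: "invertible A"
  shows "quad_inv (M ** A ** transpose M) (M *v u) = quad_inv A u"
proof -
  have M': "invertible (transpose M)" using M by (rule invertible_transpose)
  then obtain N where N: "transpose M ** N = mat 1"
    unfolding invertible_def by blast
  have "(M ** A ** transpose M) *v (N *v (matrix_inv A *v u)) = (M ** (A ** (transpose M ** N) ** matrix_inv A)) *v u"
    by (simp add: matrix_vector_mul_assoc matrix_mul_assoc)
  also have "\<dots> = M *v u"
    by (simp add: N matrix_inv_mult(1)[OF A])
  finally have "quad_inv (M ** A ** transpose M) (M *v u) = (M *v u) \<bullet> (N *v (matrix_inv A *v u))"
    using M M' A by (intro quad_inv_eqI invertible_mult)
  also have "\<dots> = u \<bullet> ((transpose M ** N) *v (matrix_inv A *v u))"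
    by (simp only: inner_matrix_vector_transpose matrix_vector_mul_assoc matrix_mul_assoc)
  finally show ?thesis by (simp add: N quad_inv_def)
qed

lemma scatter_matrix_invertible:
  assumes "scatter_matrix A"
  shows "invertible A"
proof -
  have "x = 0" if "A *v x = 0" for x
    using assms that by (force simp: scatter_matrix_def)
  then show ?thesis
    by (metis invertible_left_inverse matrix_left_invertible_ker)
qed

section \<open>Orthonormalization and factorization of a scatter matrix\<close>

lemma scatter_matrix_symmetric:
  "scatter_matrix A \<Longrightarrow> x \<bullet> (A *v y) = y \<bullet> (A *v x)"
  by (metis inner_commute inner_matrix_vector_transpose scatter_matrix_def)

text \<open>Gram-Schmidt for the inner product \<open>x \<bullet> (A *v y)\<close>. The index set
  \<open>I\<close> carries the induction; \<open>I = UNIV\<close> gives a full basis.\<close>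

lemma scatter_matrix_orthonormal_family:
  fixes A :: "real ^ 'd::finite ^ 'd"
  assumes A: "scatter_matrix A"
  shows "\<exists>f :: 'd \<Rightarrow> real ^ 'd. \<forall>i\<in>I. \<forall>j\<in>I. f i \<bullet> (A *v f j) = of_bool (i = j)"
proof (induction I rule: finite_induct[OF finite])
  case 1
  then show ?case by simp
next
  case (2 k I)
  then obtain f :: "'d \<Rightarrow> real ^ 'd"
    where f: "\<And>i j. i \<in> I \<Longrightarrow> j \<in> I \<Longrightarrow> f i \<bullet> (A *v f j) = of_bool (i = j)" by blast
  \<comment> \<open>Fewer vectors than the dimension cannot span, which leaves room for a new vector
    \<open>v\<close>.\<close>
  have "dim (f ` I) \<le> card (f ` I)" by (simp add: dim_le_card')
  also have "\<dots> \<le> card I" by (simp add: card_image_le)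
  also have "\<dots> < CARD('d)" using 2 by (metis UNIV_I finite psubset_card_mono psubsetI subset_UNIV)
  finally have "dim (f ` I) < DIM(real ^ 'd)" by simp
  then have "span (f ` I) \<noteq> UNIV" by (metis dim_UNIV dim_span less_irrefl)
  then obtain v where v: "v \<notin> span (f ` I)" by blast
  \<comment> \<open>The projection of \<open>v\<close> for the \<open>A\<close>-inner product is
    removed; \<open>w\<close> is nonzero since \<open>v\<close> lies outside the span, so it can be
    normalized.\<close>
  define w where "w = v - (\<Sum>i\<in>I. (f i \<bullet> (A *v v)) *\<^sub>R f i)"
  have "(\<Sum>i\<in>I. (f i \<bullet> (A *v v)) *\<^sub>R f i) \<in> span (f ` I)"
    by (intro span_sum span_scale span_base) auto
  then have "w \<noteq> 0" using v by (auto simp: w_def)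
  then have pos: "w \<bullet> (A *v w) > 0" using A by (simp add: scatter_matrix_def)
  have ortho: "f j \<bullet> (A *v w) = 0" if j: "j \<in> I" for j
  proof -
    have "f j \<bullet> (A *v w) = w \<bullet> (A *v f j)" by (rule scatter_matrix_symmetric[OF A])
    also have "\<dots> = v \<bullet> (A *v f j) - (\<Sum>i\<in>I. (f i \<bullet> (A *v v)) * (f i \<bullet> (A *v f j)))"
      by (simp add: w_def inner_diff_left inner_sum_left)
    also have "(\<Sum>i\<in>I. (f i \<bullet> (A *v v)) * (f i \<bullet> (A *v f j))) = (\<Sum>i\<in>I. if i = j then f i \<bullet> (A *v v) else 0)"
      by (intro sum.cong) (auto simp: f j)
    also have "\<dots> = f j \<bullet> (A *v v)" using j 2 by simp
    finally show ?thesis by (simp add: scatter_matrix_symmetric[OF A, of v])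
  qed
  define u where "u = (1 / sqrt (w \<bullet> (A *v w))) *\<^sub>R w"
  have uu: "u \<bullet> (A *v u) = 1"
    using pos by (simp add: u_def matrix_vector_mult_scaleR field_simps)
  have fu: "f j \<bullet> (A *v u) = 0" "u \<bullet> (A *v f j) = 0" if j: "j \<in> I" for j
    using ortho[OF j] scatter_matrix_symmetric[OF A, of w "f j"]
    by (simp_all add: u_def matrix_vector_mult_scaleR)
  show ?case
  proof (intro exI[of _ "f(k := u)"] ballI)
    fix i j assume ij: "i \<in> insert k I" "j \<in> insert k I"
    show "(f(k := u)) i \<bullet> (A *v (f(k := u)) j) = of_bool (i = j)"
      using ij 2(2) by (cases "i = k"; cases "j = k") (simp_all add: f uu fu)
  qed
qed

text \<open>An \<open>A\<close>-orthonormal family as the columns of \<open>M\<close> gives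
  \<open>transpose M ** A ** M = mat 1\<close>; solving for \<open>A\<close> makes the transposed
  inverse of \<open>M\<close> the factor \<open>L\<close>.\<close>

lemma scatter_matrix_factorization:
  fixes A :: "real ^ 'd::finite ^ 'd"
  assumes A: "scatter_matrix A"
  obtains L :: "real ^ 'd ^ 'd" where "invertible L" "A = L ** transpose L"
proof -
  obtain f :: "'d \<Rightarrow> real ^ 'd" where f: "\<And>i j. f i \<bullet> (A *v f j) = of_bool (i = j)"
    using scatter_matrix_orthonormal_family[OF A, of UNIV] by blast
  define M :: "real ^ 'd ^ 'd" where "M = (\<chi> i j. f j $ i)"
  have col: "M *v axis j 1 = f j" for j
    by (simp add: M_def vec_eq_iff matrix_vector_mult_def axis_def if_distrib cong: if_cong)
  have "(transpose M ** A ** M) $ i $ j = mat 1 $ i $ j" for i j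
  proof -
    have "(transpose M ** A ** M) $ i $ j = axis i 1 \<bullet> ((transpose M ** A ** M) *v axis j 1)"
      by (simp add: inner_axis' matrix_vector_mult_basis column_def)
    also have "\<dots> = (M *v axis i 1) \<bullet> (A *v (M *v axis j 1))"
      by (simp add: inner_matrix_vector_transpose matrix_vector_mul_assoc matrix_mul_assoc)
    finally show ?thesis by (simp add: col f mat_def)
  qed
  then have MAM: "transpose M ** A ** M = mat 1" by (simp add: vec_eq_iff)
  then have "invertible M" using invertible_left_inverse by blast
  note N = matrix_inv_mult[OF this]
  define N where "N = matrix_inv M"
  have "A = transpose N ** (transpose M ** A ** M) ** N"
  proof -
    have "transpose N ** (transpose M ** A ** M) ** N = transpose (M ** N) ** A ** (M ** N)"
      by (simp add: matrix_transpose_mul matrix_mul_assoc)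
    then show ?thesis by (simp add: N_def N)
  qed
  then have "A = transpose N ** transpose (transpose N)" by (simp add: MAM)
  moreover have "invertible (transpose N)"
    unfolding N_def by (rule invertible_transpose) (use N in \<open>unfold invertible_def, blast\<close>)
  ultimately show thesis by (rule that[rotated])
qed

lemma det_scatter_matrix_pos:
  fixes A :: "real ^ 'd::finite ^ 'd"
  assumes "scatter_matrix A"
  shows "det A > 0"
proof -
  obtain L :: "real ^ 'd ^ 'd" where L: "invertible L" "A = L ** transpose L"
    by (rule scatter_matrix_factorization[OF assms])
  have "det A = (det L)\<^sup>2" by (subst L(2)) (simp add: det_mul power2_eq_square)
  then show ?thesis using L(1) by (simp add: invertible_det_nz)
qed

text \<open>With \<open>w\<close> the preimage of \<open>v\<close> under \<open>A\<close>, the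
  inverse form at \<open>v\<close> is the form of \<open>A\<close> at \<open>w\<close>.\<close>

lemma quad_inv_pos:
  assumes A: "scatter_matrix A" and v: "v \<noteq> 0"
  shows "quad_inv A v > 0"
proof -
  note inv = scatter_matrix_invertible[OF A]
  define w where "w = matrix_inv A *v v"
  have Aw: "A *v w = v" by (simp add: w_def matrix_vector_mul_assoc matrix_inv_mult(1)[OF inv])
  then have "w \<noteq> 0" using v by auto
  then have "w \<bullet> (A *v w) > 0" using A by (simp add: scatter_matrix_def)
  then show ?thesis
    using quad_inv_eqI[OF inv Aw] Aw by (simp add: inner_commute)
qed

lemma quad_inv_nonneg: "scatter_matrix A \<Longrightarrow> quad_inv A v \<ge> 0"
  using quad_inv_pos[of A v] by (cases "v = 0") (auto simp: quad_inv_def)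

lemma quad_inv_scaleR:
  assumes A: "invertible A" and c: "c \<noteq> 0"
  shows "quad_inv (c *\<^sub>R A) v = quad_inv A v / c"
proof -
  have "A *v (matrix_inv A *v v) = v"
    by (simp add: matrix_vector_mul_assoc matrix_inv_mult(1)[OF A])
  then have "(c *\<^sub>R A) *v ((1 / c) *\<^sub>R (matrix_inv A *v v)) = v"
    using c by (simp add: matrix_vector_mult_scaleR scaleR_matrix_vector_assoc[symmetric])
  moreover have "invertible (c *\<^sub>R A)"
    using A c by (simp add: scalar_invertible)
  ultimately have "quad_inv (c *\<^sub>R A) v = v \<bullet> ((1 / c) *\<^sub>R (matrix_inv A *v v))"
    by (intro quad_inv_eqI)
  then show ?thesis by (simp add: quad_inv_def)
qed

lemma scatter_matrix_scaleR:
  "scatter_matrix A \<Longrightarrow> c > 0 \<Longrightarrow> scatter_matrix (c *\<^sub>R A)"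
  by (auto simp: scatter_matrix_def transpose_def vec_eq_iff scaleR_matrix_vector_assoc[symmetric])

lemma det_scaleR: "det (c *\<^sub>R A :: real ^ 'd::finite ^ 'd) = c ^ CARD('d) * det A"
proof -
  have "c *\<^sub>R A = mat c ** A"
    by (simp add: vec_eq_iff matrix_matrix_mult_def mat_def if_distrib[of "\<lambda>x. x * y" for y] cong: if_cong)
  then show ?thesis by (simp add: det_mul det_mat)
qed

section \<open>Block diagonal forms and Schur complements\<close>

lemma invertible_block_diagonal:
  "invertible A \<Longrightarrow> invertible D \<Longrightarrow> invertible (block_matrix A 0 0 D)"
  by (simp add: invertible_det_nz det_block_diagonal)

lemma quad_inv_block_diagonal:
  assumes A: "invertible A" and D: "invertible D"
  shows "quad_inv (block_matrix A 0 0 D) (join_vec u v) = quad_inv A u + quad_inv D v"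
proof -
  have "block_matrix A 0 0 D *v join_vec (matrix_inv A *v u) (matrix_inv D *v v) = join_vec u v"
    by (simp add: block_matrix_vector_mult matrix_vector_mul_assoc matrix_inv_mult(1) A D)
  from quad_inv_eqI[OF invertible_block_diagonal[OF A D] this] show ?thesis
    by (simp add: quad_inv_def inner_join_vec)
qed

lemma transpose_zero: "transpose 0 = 0"
  by (simp add: vec_eq_iff transpose_def)

definition schur_complement :: "real ^ ('m::finite + 'n::finite) ^ ('m + 'n) \<Rightarrow> real ^ 'n ^ 'n" where
  "schur_complement A = submat Inr Inr A -
      submat Inr Inl A ** matrix_inv (submat Inl Inl A) ** submat Inl Inr A"

text \<open>The unipotent factor of the block elimination; its off-diagonal block is the regression
  matrix that also occurs in \<open>cond_mean\<close>.\<close>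

definition schur_factor :: "real ^ ('m::finite + 'n::finite) ^ ('m + 'n) \<Rightarrow> real ^ ('m + 'n) ^ ('m + 'n)" where
  "schur_factor A = block_matrix (mat 1) 0 (submat Inr Inl A ** matrix_inv (submat Inl Inl A)) (mat 1)"

lemma scatter_matrix_submat_Inl:
  assumes A: "scatter_matrix A"
  shows "scatter_matrix (submat Inl Inl A)"
  unfolding scatter_matrix_def
proof (intro conjI allI impI)
  have "transpose A = A" using A by (simp add: scatter_matrix_def)
  then show "transpose (submat Inl Inl A) = submat Inl Inl A"
    by (metis (no_types) block_matrix_eq_iff block_matrix_submat transpose_block_matrix)
next
  fix v :: "real ^ 'a" assume "v \<noteq> 0"
  then have "0 < join_vec v 0 \<bullet> (A *v join_vec v (0 :: real ^ 'b))"
    using A by (simp add: scatter_matrix_def join_vec_eq_0_iff)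
  also have "\<dots> = v \<bullet> (submat Inl Inl A *v v)"
    using block_matrix_vector_mult[of "submat Inl Inl A" "submat Inl Inr A" "submat Inr Inl A" "submat Inr Inr A" v 0]
    by (simp add: block_matrix_submat inner_join_vec)
  finally show "0 < v \<bullet> (submat Inl Inl A *v v)" .
qed

text \<open>Multiplying out leaves identities between blocks: \<open>X ** ?P = ?Q\<close> cancels
  the inverse, its transpose gives the upper right block, and both together turn
  \<open>?Q ** transpose X\<close> into the term subtracted in the Schur complement.\<close>

lemma schur_decomposition:
  assumes A: "scatter_matrix A"
  shows "A = schur_factor A ** block_matrix (submat Inl Inl A) 0 0 (schur_complement A) **
             transpose (schur_factor A)"
proof -
  let ?P = "submat Inl Inl A" and ?Q = "submat Inr Inl A"
  define X where "X = ?Q ** matrix_inv ?P"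
  have "transpose A = A" using A by (simp add: scatter_matrix_def)
  then have tr: "transpose ?Q = submat Inl Inr A" "transpose ?P = ?P"
    by (metis (no_types) block_matrix_eq_iff block_matrix_submat transpose_block_matrix)+
  have "invertible ?P" by (intro scatter_matrix_invertible scatter_matrix_submat_Inl A)
  then have XP: "X ** ?P = ?Q"
    by (simp add: X_def matrix_mul_assoc[symmetric] matrix_inv_mult(2))
  then have PX: "?P ** transpose X = submat Inl Inr A"
    by (metis matrix_transpose_mul tr)
  have "?Q ** transpose X = X ** submat Inl Inr A"
    by (metis PX XP matrix_mul_assoc)
  then have "?Q ** transpose X + schur_complement A = submat Inr Inr A"
    unfolding schur_complement_def X_def[symmetric] by simp
  then have "schur_factor A ** block_matrix ?P 0 0 (schur_complement A) ** transpose (schur_factor A)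
      = block_matrix ?P (submat Inl Inr A) ?Q (submat Inr Inr A)"
    by (simp add: schur_factor_def X_def[symmetric] transpose_block_matrix block_matrix_mult XP PX transpose_zero)
  then show ?thesis by (simp only: block_matrix_submat)
qed

lemma scatter_matrix_schur_complement:
  assumes A: "scatter_matrix A"
  shows "scatter_matrix (schur_complement A)"
  unfolding scatter_matrix_def
proof (intro conjI allI impI)
  let ?P = "submat Inl Inl A" and ?U = "schur_factor A" and ?S = "schur_complement A"
  let ?X = "submat Inr Inl A ** matrix_inv ?P"
  let ?D = "block_matrix ?P 0 0 ?S"
  have U: "invertible ?U"
    by (simp add: schur_factor_def invertible_det_nz det_block_unipotent)
  have "transpose A = A" using A by (simp add: scatter_matrix_def)
  then have "transpose (?U ** ?D ** transpose ?U) = ?U ** ?D ** transpose ?U"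
    by (simp only: schur_decomposition[OF A, symmetric])
  then have "?U ** transpose ?D ** transpose ?U = ?U ** ?D ** transpose ?U"
    by (simp only: matrix_transpose_mul transpose_transpose matrix_mul_assoc)
  \<comment> \<open>Symmetry passes to the middle factor once the invertible outer factors are
    cancelled.\<close>
  then have "matrix_inv ?U ** (?U ** transpose ?D ** transpose ?U) ** transpose (matrix_inv ?U)
           = matrix_inv ?U ** (?U ** ?D ** transpose ?U) ** transpose (matrix_inv ?U)" by simp
  moreover have "matrix_inv ?U ** (?U ** Y ** transpose ?U) ** transpose (matrix_inv ?U) = Y" for Y
  proof -
    have "matrix_inv ?U ** (?U ** Y ** transpose ?U) ** transpose (matrix_inv ?U)
        = (matrix_inv ?U ** ?U) ** Y ** transpose (matrix_inv ?U ** ?U)"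
      by (simp add: matrix_mul_assoc matrix_transpose_mul)
    then show ?thesis by (simp add: matrix_inv_mult(2)[OF U])
  qed
  ultimately have "transpose ?D = ?D" by simp
  then show "transpose ?S = ?S"
    by (simp add: transpose_block_matrix block_matrix_eq_iff)
  fix v :: "real ^ 'b" assume v: "v \<noteq> 0"
  \<comment> \<open>Chosen so that \<open>transpose ?U\<close> maps it to
    \<open>join_vec 0 v\<close>, where the form of \<open>?D\<close> sees only the Schur
    complement.\<close>
  define w where "w = join_vec (- (transpose ?X *v v)) v"
  have "transpose ?U *v w = join_vec 0 v"
    by (simp add: schur_factor_def w_def transpose_block_matrix block_matrix_vector_mult)
  moreover have "w \<bullet> ((?U ** ?D ** transpose ?U) *v w) = (transpose ?U *v w) \<bullet> (?D *v (transpose ?U *v w))"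
    unfolding matrix_vector_mul_assoc[symmetric]
    by (subst inner_commute, subst inner_matrix_vector_transpose, rule inner_commute)
  ultimately have "w \<bullet> (A *v w) = join_vec 0 v \<bullet> (?D *v join_vec 0 v)"
    by (simp only: schur_decomposition[OF A, symmetric])
  also have "\<dots> = v \<bullet> (?S *v v)"
    by (simp add: block_matrix_vector_mult inner_join_vec)
  finally have "w \<bullet> (A *v w) = v \<bullet> (?S *v v)" .
  moreover have "w \<noteq> 0" using v by (simp add: w_def join_vec_eq_0_iff)
  ultimately show "0 < v \<bullet> (?S *v v)"
    using A by (metis scatter_matrix_def)
qed

lemma det_schur:
  assumes "scatter_matrix A"
  shows "det A = det (submat Inl Inl A) * det (schur_complement A)"
proof -
  have "det (schur_factor A) = 1" by (simp only: schur_factor_def det_block_unipotent)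
  then show ?thesis
    using arg_cong[OF schur_decomposition[OF assms], of det]
    by (simp add: det_mul det_block_diagonal)
qed

text \<open>\<open>schur_factor A\<close> maps \<open>join_vec u (v - ?X *v u)\<close> to
  \<open>join_vec u v\<close>, so congruence invariance reduces the claim to the block diagonal
  case.\<close>

lemma quad_inv_join_vec:
  assumes A: "scatter_matrix A"
  shows "quad_inv A (join_vec u v) =
           quad_inv (submat Inl Inl A) u +
           quad_inv (schur_complement A) (v - (submat Inr Inl A ** matrix_inv (submat Inl Inl A)) *v u)"
    (is "_ = quad_inv ?P u + quad_inv ?S (v - ?X *v u)")
proof -
  have inv: "invertible ?P" "invertible ?S"
    by (intro scatter_matrix_invertible scatter_matrix_submat_Inl scatter_matrix_schur_complement A)+
  have U: "invertible (schur_factor A)"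
    by (simp add: schur_factor_def invertible_det_nz det_block_unipotent)
  have "join_vec u v = schur_factor A *v join_vec u (v - ?X *v u)"
    by (simp add: schur_factor_def block_matrix_vector_mult)
  then have "quad_inv (schur_factor A ** block_matrix ?P 0 0 ?S ** transpose (schur_factor A)) (join_vec u v)
      = quad_inv (block_matrix ?P 0 0 ?S) (join_vec u (v - ?X *v u))"
    by (simp only: quad_inv_congruence[OF U invertible_block_diagonal[OF inv]])
  then have "quad_inv A (join_vec u v) = quad_inv (block_matrix ?P 0 0 ?S) (join_vec u (v - ?X *v u))"
    by (simp only: schur_decomposition[OF A, symmetric])
  then show ?thesis by (simp add: quad_inv_block_diagonal inv)
qed

subsection \<open>Linear change of variables\<close>

lemma measurable_matrix_vector_mult [measurable]:
  "(\<lambda>x. (A :: real^'n::finite^'m::finite) *v x) \<in> borel_measurable borel"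
  by (intro borel_measurable_continuous_onI continuous_intros)

text \<open>A diagonal matrix scales each coordinate separately, an instance of the coordinatewise
  affine change of variables for \<open>lborel\<close>.\<close>

lemma nn_integral_lborel_diagonal_matrix:
  fixes A :: "real ^ 'd::finite ^ 'd"
  assumes [measurable]: "f \<in> borel_measurable borel"
    and diag: "\<And>i j. i \<noteq> j \<Longrightarrow> A $ i $ j = 0" and det: "det A \<noteq> 0"
  shows "\<bar>det A\<bar> * (\<integral>\<^sup>+x. f (A *v x) \<partial>lborel) = (\<integral>\<^sup>+x. f x \<partial>lborel)"
proof -
  have dA: "det A = (\<Prod>i\<in>UNIV. A $ i $ i)" using diag by (rule det_diagonal)
  \<comment> \<open>The scaling factors are indexed by basis vectors; at \<open>axis i 1\<close> the
    value is the diagonal entry.\<close>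
  define c where "c b = b \<bullet> (A *v b)" for b
  have c: "c (axis i 1) = A $ i $ i" for i
    by (simp add: c_def inner_axis' matrix_vector_mult_basis column_def)
  have T: "(\<lambda>x. 0 + (\<Sum>b\<in>Basis. (c b * (x \<bullet> b)) *\<^sub>R b)) = (\<lambda>x. A *v x)"
  proof
    fix x
    have "(A *v x) $ i = A $ i $ i * x $ i" for i
    proof -
      have "(A *v x) $ i = (\<Sum>j\<in>UNIV. if j = i then A $ i $ i * x $ i else 0)"
        unfolding matrix_vector_mult_def vec_lambda_beta by (rule sum.cong) (use diag in auto)
      then show ?thesis by simp
    qed
    moreover have "(\<Sum>b\<in>Basis. (c b * (x \<bullet> b)) *\<^sub>R b) = (\<Sum>i\<in>UNIV. (A $ i $ i * x $ i) *\<^sub>R axis i 1)"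
      unfolding Basis_vec_def
      by (simp add: sum.UNION_disjoint c cart_eq_inner_axis[symmetric] axis_eq_axis)
    ultimately show "0 + (\<Sum>b\<in>Basis. (c b * (x \<bullet> b)) *\<^sub>R b) = A *v x"
      by (simp add: vec_eq_iff axis_def if_distrib cong: if_cong)
  qed
  have cn: "c b \<noteq> 0" if "b \<in> Basis" for b
    using that det dA by (auto simp: Basis_vec_def c)
  have pr: "(\<Prod>b\<in>Basis. \<bar>c b\<bar>) = \<bar>det A\<bar>"
    unfolding Basis_vec_def dA
    by (simp add: prod.UNION_disjoint c axis_eq_axis abs_prod)
  have "(\<integral>\<^sup>+x. f x \<partial>lborel) = (\<integral>\<^sup>+x. f x \<partial>density (distr lborel borel (\<lambda>x. A *v x)) (\<lambda>_. \<bar>det A\<bar>))"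
    using lborel_affine_euclidean[where c = c and t = 0, OF cn] by (simp only: T pr)
  also have "\<dots> = \<bar>det A\<bar> * (\<integral>\<^sup>+x. f (A *v x) \<partial>lborel)"
    by (simp add: nn_integral_density nn_integral_distr nn_integral_cmult)
  finally show ?thesis by simp
qed

text \<open>Permuting coordinates permutes the side lengths of a box and so keeps its volume, and
  volumes of boxes determine \<open>lborel\<close>.\<close>

lemma nn_integral_lborel_swap_matrix:
  fixes m n :: "'d::finite"
  assumes [measurable]: "f \<in> borel_measurable borel"
  shows "(\<integral>\<^sup>+x. f (((\<chi> i j. mat 1 $ i $ Transposition.transpose m n j) :: real ^ 'd ^ 'd) *v x) \<partial>lborel)
       = (\<integral>\<^sup>+x. f x \<partial>lborel)"
proof -
  define P :: "real ^ 'd ^ 'd" where "P = (\<chi> i j. mat 1 $ i $ Transposition.transpose m n j)"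
  let ?t = "Transposition.transpose m n"
  have P: "(P *v x) $ i = x $ ?t i" for x i
  proof -
    have "(P *v x) $ i = (\<Sum>j\<in>UNIV. if j = ?t i then x $ j else 0)"
      unfolding P_def matrix_vector_mult_def mat_def vec_lambda_beta
      by (rule sum.cong) (auto simp: transpose_eq_iff)
    then show ?thesis by simp
  qed
  have "lborel = distr lborel borel (\<lambda>x. P *v x)"
  proof (rule lborel_eqI)
    fix l u :: "real ^ 'd" assume lu: "\<And>b. b \<in> Basis \<Longrightarrow> l \<bullet> b \<le> u \<bullet> b"
    then have lu': "l $ i \<le> u $ i" for i
      by (metis axis_in_Basis_iff cart_eq_inner_axis insertI1 Basis_real_def)
    have bij: "bij ?t" by simp
    have "(\<lambda>x. P *v x) -` box l u = box (P *v l) (P *v u)"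
      by (auto simp: mem_box_cart P) (metis transpose_involutory)+
    then have "emeasure (distr lborel borel (\<lambda>x. P *v x)) (box l u) = emeasure lborel (box (P *v l) (P *v u))"
      by (simp add: emeasure_distr)
    also have "\<dots> = (\<Prod>b\<in>Basis. (P *v u - P *v l) \<bullet> b)"
      by (rule emeasure_lborel_box) (auto simp: Basis_vec_def cart_eq_inner_axis[symmetric] P lu')
    also have "(\<Prod>b\<in>Basis. (P *v u - P *v l) \<bullet> b) = (\<Prod>i\<in>UNIV. u $ ?t i - l $ ?t i)"
      unfolding Basis_vec_def
      by (simp add: prod.UNION_disjoint axis_eq_axis cart_eq_inner_axis[symmetric] P)
    also have "\<dots> = (\<Prod>i\<in>UNIV. u $ i - l $ i)"
      by (rule prod.reindex_bij_betw[OF bij, of "\<lambda>i. u $ i - l $ i"])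
    also have "\<dots> = (\<Prod>b\<in>Basis. (u - l) \<bullet> b)"
      unfolding Basis_vec_def
      by (simp add: prod.UNION_disjoint axis_eq_axis cart_eq_inner_axis[symmetric])
    finally show "emeasure (distr lborel borel (\<lambda>x. P *v x)) (box l u) = (\<Prod>b\<in>Basis. (u - l) \<bullet> b)" .
  qed simp
  then have "(\<integral>\<^sup>+x. f x \<partial>lborel) = (\<integral>\<^sup>+x. f x \<partial>distr lborel borel (\<lambda>x. P *v x))"
    by simp
  also have "\<dots> = (\<integral>\<^sup>+x. f (P *v x) \<partial>lborel)" by (simp add: nn_integral_distr)
  finally show ?thesis by (simp add: P_def)
qed

text \<open>With coordinate \<open>m\<close> as the inner variable of integration, the shear is a
  translation by \<open>c * x $ n\<close>, constant there because \<open>n\<close> is another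
  coordinate; translations preserve the inner integral.\<close>

lemma nn_integral_lborel_shear_matrix:
  fixes m n :: "'d::finite"
  assumes [measurable]: "f \<in> borel_measurable borel" and mn: "m \<noteq> n"
  shows "(\<integral>\<^sup>+x. f (((\<chi> i j. if i = m \<and> j = n then c else of_bool (i = j)) :: real ^ 'd ^ 'd) *v x) \<partial>lborel)
       = (\<integral>\<^sup>+x. f x \<partial>lborel)"
proof -
  define S :: "real ^ 'd ^ 'd" where "S = (\<chi> i j. if i = m \<and> j = n then c else of_bool (i = j))"
  have S: "S *v x = x + (c * x $ n) *\<^sub>R axis m 1" for x
  proof -
    have "(S *v x) $ i = (x + (c * x $ n) *\<^sub>R axis m 1) $ i" for i
    proof -
      have "(S *v x) $ i = (\<Sum>j\<in>UNIV. (if j = i then x $ j else 0) + (if j = n then (if i = m then c * x $ j else 0) else 0))"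
        unfolding S_def matrix_vector_mult_def vec_lambda_beta by (rule sum.cong) (use mn in auto)
      also have "\<dots> = x $ i + (if i = m then c * x $ n else 0)"
        by (simp add: sum.distrib)
      finally show ?thesis by (simp add: axis_def)
    qed
    then show ?thesis by (simp add: vec_eq_iff)
  qed
  let ?b = "axis m 1 :: real ^ 'd"
  let ?R = "Basis - {?b}"
  \<comment> \<open>\<open>?v\<close> assembles a vector from all its coordinates, \<open>?w\<close>
    from all but coordinate \<open>m\<close>.\<close>
  let ?v = "\<lambda>g. \<Sum>b\<in>Basis. g b *\<^sub>R (b :: real ^ 'd)"
  let ?w = "\<lambda>g. \<Sum>b\<in>?R. g b *\<^sub>R (b :: real ^ 'd)"
  have b: "?b \<in> Basis" by (simp add: axis_in_Basis_iff)
  have ins: "(Basis :: (real ^ 'd) set) = insert ?b ?R" using b by auto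
  interpret product_sigma_finite "\<lambda>_ :: real ^ 'd. lborel :: real measure" ..
  have fubini: "(\<integral>\<^sup>+x. h x \<partial>lborel)
      = (\<integral>\<^sup>+g. (\<integral>\<^sup>+t. h (t *\<^sub>R ?b + ?w g) \<partial>lborel) \<partial>Pi\<^sub>M ?R (\<lambda>_. lborel))"
    if [measurable]: "h \<in> borel_measurable borel" for h :: "real ^ 'd \<Rightarrow> ennreal"
  proof -
    have "(\<integral>\<^sup>+x. h x \<partial>lborel) = (\<integral>\<^sup>+g. h (?v g) \<partial>Pi\<^sub>M Basis (\<lambda>_. lborel))"
      by (subst lborel_eq) (simp add: nn_integral_distr)
    also have "\<dots> = (\<integral>\<^sup>+g. h (?v g) \<partial>Pi\<^sub>M (insert ?b ?R) (\<lambda>_. lborel))"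
      using ins by simp
    also have "\<dots> = (\<integral>\<^sup>+g. (\<integral>\<^sup>+t. h (?v (g(?b := t))) \<partial>lborel) \<partial>Pi\<^sub>M ?R (\<lambda>_. lborel))"
    proof (rule product_nn_integral_insert)
      show "(\<lambda>g. h (?v g)) \<in> borel_measurable (Pi\<^sub>M (insert ?b ?R) (\<lambda>_. lborel))"
        unfolding ins[symmetric] by measurable
    qed auto
    also have "\<dots> = (\<integral>\<^sup>+g. (\<integral>\<^sup>+t. h (t *\<^sub>R ?b + ?w g) \<partial>lborel) \<partial>Pi\<^sub>M ?R (\<lambda>_. lborel))"
    proof -
      have "?v (g(?b := t)) = t *\<^sub>R ?b + ?w g" for g t
        by (subst sum.remove[OF finite_Basis b]) (auto intro!: sum.cong)
      then show ?thesis by simp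
    qed
    finally show ?thesis .
  qed
  have "(\<integral>\<^sup>+x. f (S *v x) \<partial>lborel)
      = (\<integral>\<^sup>+g. (\<integral>\<^sup>+t. f (S *v (t *\<^sub>R ?b + ?w g)) \<partial>lborel) \<partial>Pi\<^sub>M ?R (\<lambda>_. lborel))"
    by (rule fubini) measurable
  also have "\<dots> = (\<integral>\<^sup>+g. (\<integral>\<^sup>+t. f (t *\<^sub>R ?b + ?w g) \<partial>lborel) \<partial>Pi\<^sub>M ?R (\<lambda>_. lborel))"
  proof (rule nn_integral_cong)
    fix g
    \<comment> \<open>The summand \<open>1 * t\<close> fits the one-dimensional affine substitution
      with factor 1.\<close>
    have "S *v (t *\<^sub>R ?b + ?w g) = (c * ?w g $ n + 1 * t) *\<^sub>R ?b + ?w g" for t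
      using mn by (simp add: S axis_def scaleR_add_left)
    then have "(\<integral>\<^sup>+t. f (S *v (t *\<^sub>R ?b + ?w g)) \<partial>lborel)
        = (\<integral>\<^sup>+t. f ((c * ?w g $ n + 1 * t) *\<^sub>R ?b + ?w g) \<partial>lborel)"
      by presburger
    also have "\<dots> = (\<integral>\<^sup>+t. f (t *\<^sub>R ?b + ?w g) \<partial>lborel)"
      by (subst nn_integral_real_affine[where c = 1 and t = "c * ?w g $ n"]) auto
    finally show "(\<integral>\<^sup>+t. f (S *v (t *\<^sub>R ?b + ?w g)) \<partial>lborel) = (\<integral>\<^sup>+t. f (t *\<^sub>R ?b + ?w g) \<partial>lborel)" .
  qed
  also have "\<dots> = (\<integral>\<^sup>+x. f x \<partial>lborel)" by (rule fubini[symmetric]) measurable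
  finally show ?thesis by (simp add: S_def)
qed

text \<open>Induction over elementary factors; a zero row contradicts the nonzero determinant. The
  function is generalized because for a product the hypothesis on \<open>B\<close> is applied to
  \<open>f\<close> composed with multiplication by \<open>A\<close>.\<close>

lemma nn_integral_lborel_matrix:
  fixes A :: "real ^ 'd::finite ^ 'd"
  assumes "f \<in> borel_measurable borel" "det A \<noteq> 0"
  shows "\<bar>det A\<bar> * (\<integral>\<^sup>+x. f (A *v x) \<partial>lborel) = (\<integral>\<^sup>+x. f x \<partial>lborel)"
  using assms
proof (induction A arbitrary: f rule: induct_matrix_elementary)
  case (1 A B)
  note [measurable] = \<open>f \<in> borel_measurable borel\<close>
  have "\<bar>det (A ** B)\<bar> * (\<integral>\<^sup>+x. f ((A ** B) *v x) \<partial>lborel)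
      = \<bar>det A\<bar> * (\<bar>det B\<bar> * (\<integral>\<^sup>+x. f (A *v (B *v x)) \<partial>lborel))"
    by (simp add: det_mul abs_mult ennreal_mult mult.assoc matrix_vector_mul_assoc)
  also have "\<dots> = \<bar>det A\<bar> * (\<integral>\<^sup>+x. f (A *v x) \<partial>lborel)"
    using 1 by (subst 1(2)) (auto simp: det_mul)
  also have "\<dots> = (\<integral>\<^sup>+x. f x \<partial>lborel)"
    using 1 by (intro 1(1)) (auto simp: det_mul)
  finally show ?case .
next
  case (2 A i)
  then show ?case using det_zero_row by metis
next
  case (3 A)
  then show ?case by (intro nn_integral_lborel_diagonal_matrix) auto
next
  case (4 m n)
  then show ?case by (simp add: det_swap_matrix nn_integral_lborel_swap_matrix)
next
  case (5 m n c)
  then show ?case by (simp add: det_shear_matrix nn_integral_lborel_shear_matrix)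
qed

lemma nn_integral_lborel_affine:
  fixes A :: "real ^ 'd::finite ^ 'd"
  assumes [measurable]: "f \<in> borel_measurable borel" and A: "det A \<noteq> 0"
  shows "(\<integral>\<^sup>+x. f x \<partial>lborel) = \<bar>det A\<bar> * (\<integral>\<^sup>+x. f (a + A *v x) \<partial>lborel)"
proof -
  have "(\<integral>\<^sup>+x. f x \<partial>lborel) = (\<integral>\<^sup>+x. f x \<partial>distr lborel borel ((+) a))"
    by (simp add: lborel_distr_plus)
  also have "\<dots> = (\<integral>\<^sup>+x. f (a + x) \<partial>lborel)" by (simp add: nn_integral_distr)
  also have "\<dots> = \<bar>det A\<bar> * (\<integral>\<^sup>+x. f (a + A *v x) \<partial>lborel)"
    by (rule nn_integral_lborel_matrix[symmetric, OF _ A]) measurable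
  finally show ?thesis .
qed

subsection \<open>The normalizing integral\<close>

lemma nn_integral_student_kernel_finite:
  fixes p :: real
  assumes p: "p > DIM('a::euclidean_space)"
  shows "(\<integral>\<^sup>+(z::'a). ennreal ((1 + z \<bullet> z) powr (- p / 2)) \<partial>lborel) < \<infinity>"
proof -
  \<comment> \<open>On the dyadic shell \<open>2 ^ k < |z| \<le> 2 ^ (k + 1)\<close> the integrand is at most \<open>2 powr (- p k)\<close>, which
    leaves a geometric series of ratio \<open>2 powr (DIM - p)\<close>.\<close>
  define V where "V = unit_ball_vol (real DIM('a))"
  have V: "V \<ge> 0" by (simp add: V_def)
  define q where "q = (2::real) powr (DIM('a) - p)"
  have q: "0 < q" "q < 1"
    using p powr_less_mono[of "DIM('a) - p" 0 2] by (auto simp: q_def)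
  have term_le: "g k \<le> suminf g" for g :: "nat \<Rightarrow> ennreal" and k
    using sum_le_suminf[of g "{k}"] by simp
  \<comment> \<open>Balls replace shells: of the series only the term with the least admissible
    \<open>k\<close> is used, and volumes of balls are explicit.\<close>
  have bound: "ennreal ((1 + z \<bullet> z) powr (- p / 2)) \<le>
      (\<Sum>k. ennreal ((2 powr - p) ^ k) * indicator (cball 0 (2 ^ Suc k)) z)" for z :: 'a
  proof -
    \<comment> \<open>Minimality gives the lower bound on the norm when \<open>k > 0\<close>; for
      \<open>k = 0\<close> the bound 1 on the integrand is enough.\<close>
    define k where "k = (LEAST k. norm z \<le> 2 ^ Suc k)"
    obtain j where "norm z < 2 ^ j" using real_arch_pow[of 2 "norm z"] by auto
    also have "(2 :: real) ^ j \<le> 2 ^ Suc j" by simp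
    finally have ex: "norm z \<le> 2 ^ Suc j" by simp
    have k: "norm z \<le> 2 ^ Suc k" unfolding k_def by (rule LeastI[of _ j]) (rule ex)
    have low: "(2 ^ k)\<^sup>2 \<le> 1 + z \<bullet> z"
    proof (cases k)
      case (Suc i)
      then have "2 ^ k < norm z"
        using not_less_Least[of i "\<lambda>k. norm z \<le> 2 ^ Suc k"] by (simp add: k_def)
      then have "(2 ^ k)\<^sup>2 \<le> (norm z)\<^sup>2" by (intro power_mono) auto
      then show ?thesis by (simp add: power2_norm_eq_inner)
    qed simp
    have "(1 + z \<bullet> z) powr (- p / 2) \<le> ((2 ^ k)\<^sup>2) powr (- p / 2)"
      using low p by (intro powr_mono2') auto
    also have "\<dots> = (2 powr - p) ^ k"
      by (simp add: powr_powr powr_realpow[symmetric] power_mult[symmetric] mult.commute)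
    finally have "ennreal ((1 + z \<bullet> z) powr (- p / 2)) \<le> ennreal ((2 powr - p) ^ k)"
      by (rule ennreal_leI)
    also have "\<dots> = ennreal ((2 powr - p) ^ k) * indicator (cball 0 (2 ^ Suc k)) z"
      using k by simp
    also have "\<dots> \<le> (\<Sum>k. ennreal ((2 powr - p) ^ k) * indicator (cball 0 (2 ^ Suc k)) z)"
      by (rule term_le)
    finally show ?thesis .
  qed
  have "(\<integral>\<^sup>+(z::'a). ennreal ((1 + z \<bullet> z) powr (- p / 2)) \<partial>lborel)
      \<le> (\<integral>\<^sup>+(z::'a). (\<Sum>k. ennreal ((2 powr - p) ^ k) * indicator (cball 0 (2 ^ Suc k)) z) \<partial>lborel)"
    by (intro nn_integral_mono bound)
  also have "\<dots> = (\<Sum>k. ennreal ((2 powr - p) ^ k) * emeasure lborel (cball (0::'a) (2 ^ Suc k)))"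
  proof (rule trans[OF nn_integral_suminf])
    show "(\<lambda>z::'a. ennreal ((2 powr - p) ^ k) * indicator (cball 0 (2 ^ Suc k)) z)
        \<in> borel_measurable lborel" for k
      by (intro borel_measurable_times_ennreal borel_measurable_const borel_measurable_indicator) simp
    show "(\<Sum>k. \<integral>\<^sup>+(z::'a). ennreal ((2 powr - p) ^ k) * indicator (cball 0 (2 ^ Suc k)) z \<partial>lborel)
        = (\<Sum>k. ennreal ((2 powr - p) ^ k) * emeasure lborel (cball (0::'a) (2 ^ Suc k)))"
      by (intro suminf_cong nn_integral_cmult_indicator) simp
  qed
  also have "\<dots> = (\<Sum>k. ennreal (V * 2 ^ DIM('a) * q ^ k))"
  proof (intro suminf_cong)
    fix k
    \<comment> \<open>The ratio combines the decay \<open>2 powr - p\<close> of the integrand with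
      the growth \<open>2 ^ DIM('a)\<close> of the volume.\<close>
    have "q = 2 powr - p * 2 ^ DIM('a)"
      by (simp add: q_def powr_diff powr_minus powr_realpow divide_inverse)
    then have qk: "q ^ k = (2 powr - p) ^ k * (2 ^ DIM('a)) ^ k" by (simp only: power_mult_distrib)
    have pk: "((2::real) ^ Suc k) ^ DIM('a) = 2 ^ DIM('a) * (2 ^ DIM('a)) ^ k"
      by (simp only: power_mult[symmetric] mult.commute[of "Suc k"]) (simp only: power_mult power_Suc)
    have "ennreal ((2 powr - p) ^ k) * emeasure lborel (cball (0::'a) (2 ^ Suc k))
        = ennreal ((2 powr - p) ^ k) * ennreal (V * (2 ^ Suc k) ^ DIM('a))"
      unfolding V_def by (subst emeasure_cball) auto
    also have "\<dots> = ennreal ((2 powr - p) ^ k * (V * (2 ^ Suc k) ^ DIM('a)))"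
      by (rule ennreal_mult[symmetric]) (use V in auto)
    also have "(2 powr - p) ^ k * (V * (2 ^ Suc k) ^ DIM('a)) = V * 2 ^ DIM('a) * q ^ k"
      unfolding qk pk by (simp only: mult_ac)
    finally show "ennreal ((2 powr - p) ^ k) * emeasure lborel (cball (0::'a) (2 ^ Suc k))
        = ennreal (V * 2 ^ DIM('a) * q ^ k)" .
  qed
  also have "\<dots> < \<infinity>"
  proof -
    have "summable (\<lambda>k. V * 2 ^ DIM('a) * q ^ k)" using q by (intro summable_mult summable_geometric) auto
    then show ?thesis using V q by (subst suminf_ennreal2) auto
  qed
  finally show ?thesis .
qed

text \<open>The space enters through a type argument, and location and scale do not enter at all;
  this is why one constant can normalize every case.\<close>

definition student_mass :: "real \<Rightarrow> 'a::euclidean_space itself \<Rightarrow> ennreal" where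
  "student_mass p _ = (\<integral>\<^sup>+(z::'a). ennreal ((1 + z \<bullet> z) powr (- p / 2)) \<partial>lborel)"

text \<open>The integrand is positive everywhere, so a zero integral would make the whole space a
  null set.\<close>

lemma student_mass_pos: "student_mass p TYPE('a::euclidean_space) \<noteq> 0"
proof
  assume "student_mass p TYPE('a) = 0"
  then have "emeasure lborel {z::'a. ennreal ((1 + z \<bullet> z) powr (- p / 2)) \<noteq> 0} = 0"
    unfolding student_mass_def by (subst (asm) nn_integral_0_iff) auto
  moreover have "1 + z \<bullet> z > 0" for z :: 'a
    by (simp add: add_pos_nonneg)
  then have "{z::'a. ennreal ((1 + z \<bullet> z) powr (- p / 2)) \<noteq> 0} = UNIV"
    by (auto simp: ennreal_eq_0_iff) (metis less_irrefl)
  ultimately show False by simp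
qed

lemma measurable_quad_inv [measurable]: "quad_inv A \<in> borel_measurable borel"
  unfolding quad_inv_def[abs_def] by measurable

text \<open>Substituting \<open>y = a + L *v z\<close> with \<open>T = L ** transpose L\<close>
  turns the quadratic form into \<open>z \<bullet> z\<close>; the Jacobian is
  \<open>sqrt (det T)\<close>.\<close>

lemma nn_integral_student_kernel:
  fixes T :: "real ^ 'n::finite ^ 'n"
  assumes T: "scatter_matrix T"
  shows "(\<integral>\<^sup>+y. ennreal ((1 + quad_inv T (y - a)) powr (- p / 2)) \<partial>lborel)
       = ennreal (sqrt (det T)) * student_mass p TYPE(real ^ 'n)"
proof -
  obtain L :: "real ^ 'n ^ 'n" where L: "invertible L" "T = L ** transpose L"
    by (rule scatter_matrix_factorization[OF T])
  have "quad_inv T (L *v z) = z \<bullet> z" for z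
  proof -
    have "matrix_inv (mat 1 :: real ^ 'n ^ 'n) = mat 1"
      using matrix_inv_mult(1)[of "mat 1 :: real ^ 'n ^ 'n"] by (simp add: invertible_det_nz)
    then show ?thesis
      using quad_inv_congruence[OF L(1), of "mat 1" z]
      by (simp add: L(2) invertible_det_nz quad_inv_def[of "mat 1"])
  qed
  moreover have "sqrt (det T) = \<bar>det L\<bar>"
    by (simp add: L(2) det_mul flip: power2_eq_square)
  moreover have "det L \<noteq> 0" using L(1) by (simp add: invertible_det_nz)
  ultimately show ?thesis
    by (subst nn_integral_lborel_affine[of _ L a]) (simp_all add: student_mass_def)
qed

section \<open>The conditional density as a normalized t kernel\<close>

lemma cond_scale_schur:
  "cond_scale \<mu> \<Sigma> x1 = cond_scale_factor \<mu> \<Sigma> x1 *\<^sub>R schur_complement \<Sigma>"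
  by (simp add: cond_scale_def schur_complement_def)

text \<open>Elimination replaces the deviation of the second block by its deviation from the
  regression on the first, which is centering at \<open>cond_mean\<close>.\<close>

lemma quad_inv_ag_split:
  assumes "scatter_matrix \<Sigma>"
  shows "quad_inv \<Sigma> (join_vec x1 x2 - \<mu>) =
    quad_inv (submat Inl Inl \<Sigma>) (x1 - subvec Inl \<mu>) +
    quad_inv (schur_complement \<Sigma>) (x2 - cond_mean \<mu> \<Sigma> x1)"
proof -
  have "join_vec x1 x2 - \<mu> = join_vec (x1 - subvec Inl \<mu>) (x2 - subvec Inr \<mu>)"
    by (metis join_vec_diff join_vec_subvec)
  then show ?thesis
    by (simp add: quad_inv_join_vec[OF assms] cond_mean_def diff_diff_eq)
qed

text \<open>Multiplying the scale matrix by the degrees of freedom absorbs the factor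
  \<open>1 / \<nu>\<close> of the t kernel, so density and kernel involve the same power of one
  expression in \<open>T\<close>. The condition on \<open>x1\<close> makes \<open>q\<close>
  positive, so that it can be divided out.\<close>

lemma ag_cond_density_eq:
  fixes \<mu> :: "real ^ ('m::finite + 'n::finite)"
  assumes \<Sigma>: "scatter_matrix \<Sigma>" and x1: "x1 \<noteq> subvec Inl \<mu>"
  defines "q \<equiv> quad_inv (submat Inl Inl \<Sigma>) (x1 - subvec Inl \<mu>)"
    and "T \<equiv> real CARD('m) *\<^sub>R cond_scale \<mu> \<Sigma> x1"
  shows "scatter_matrix T"
    and "ag_cond_density B C \<mu> \<Sigma> x1 x2 = B / C / sqrt (det T) *
      (1 + quad_inv T (x2 - cond_mean \<mu> \<Sigma> x1)) powr (- real (CARD('m) + CARD('n)) / 2)"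
    and "mvt_kernel (real CARD('m)) (cond_mean \<mu> \<Sigma> x1) (cond_scale \<mu> \<Sigma> x1) x2 =
      (1 + quad_inv T (x2 - cond_mean \<mu> \<Sigma> x1)) powr (- real (CARD('m) + CARD('n)) / 2)"
    and "scatter_matrix (cond_scale \<mu> \<Sigma> x1)"
proof -
  let ?m = "real CARD('m)" and ?n = "real CARD('n)"
  let ?P = "submat Inl Inl \<Sigma>" and ?S = "schur_complement \<Sigma>"
  have P: "scatter_matrix ?P" and S: "scatter_matrix ?S"
    by (rule scatter_matrix_submat_Inl scatter_matrix_schur_complement, fact \<Sigma>)+
  have q: "q > 0" unfolding q_def using x1 by (intro quad_inv_pos P) simp
  have T: "T = q *\<^sub>R ?S"
    by (simp add: T_def cond_scale_schur cond_scale_factor_def q_def)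
  show sT: "scatter_matrix T" unfolding T by (intro scatter_matrix_scaleR S q)
  have cs: "cond_scale \<mu> \<Sigma> x1 = (1 / ?m) *\<^sub>R T" by (simp add: T_def)
  show "scatter_matrix (cond_scale \<mu> \<Sigma> x1)"
    unfolding cs by (intro scatter_matrix_scaleR sT) simp
  show "mvt_kernel ?m (cond_mean \<mu> \<Sigma> x1) (cond_scale \<mu> \<Sigma> x1) x2 =
      (1 + quad_inv T (x2 - cond_mean \<mu> \<Sigma> x1)) powr (- real (CARD('m) + CARD('n)) / 2)"
    unfolding mvt_kernel_def cs
    by (subst quad_inv_scaleR) (simp_all add: scatter_matrix_invertible sT)
  define Q where "Q = quad_inv T (x2 - cond_mean \<mu> \<Sigma> x1)"
  have Q: "Q \<ge> 0" unfolding Q_def by (intro quad_inv_nonneg sT)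
  have QS: "quad_inv ?S (x2 - cond_mean \<mu> \<Sigma> x1) = q * Q"
    using q by (simp add: Q_def T quad_inv_scaleR scatter_matrix_invertible S)
  have dP: "det ?P > 0" and dS: "det ?S > 0" using P S by (simp_all add: det_scatter_matrix_pos)
  have "quad_inv \<Sigma> (join_vec x1 x2 - \<mu>) = q * (1 + Q)"
    using quad_inv_ag_split[OF \<Sigma>, of x1 x2 \<mu>] by (simp add: q_def[symmetric] QS distrib_left)
  then have "ag_cond_density B C \<mu> \<Sigma> x1 x2 =
     B * (det ?P * det ?S) powr (- 1 / 2) * (q * (1 + Q)) powr (- (?m + ?n) / 2) /
     (C * det ?P powr (- 1 / 2) * q powr (- ?m / 2))"
    by (simp add: ag_cond_density_def ag_density_def det_schur[OF \<Sigma>] q_def[symmetric])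
  \<comment> \<open>The determinants of the first block cancel, and the power of
    \<open>q * (1 + Q)\<close> splits since both factors are nonnegative.\<close>
  also have "\<dots> = B / C * (det ?S powr (- 1 / 2) * (q powr (- (?m + ?n) / 2) / q powr (- ?m / 2))) *
      (1 + Q) powr (- (?m + ?n) / 2)"
    using dP dS q Q by (simp add: powr_mult)
  \<comment> \<open>What remains of \<open>q\<close> is the factor by which scaling a matrix of size
    \<open>CARD('n)\<close> by \<open>q\<close> changes the inverse square root of its
    determinant.\<close>
  also have "q powr (- (?m + ?n) / 2) / q powr (- ?m / 2) = q powr (- ?n / 2)"
    by (simp add: powr_diff[symmetric] field_simps)
  also have "det ?S powr (- 1 / 2) * q powr (- ?n / 2) = 1 / sqrt (det T)"
  proof -
    have "sqrt (det T) = (q powr ?n * det ?S) powr (1 / 2)"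
      using q dS by (simp add: T det_scaleR powr_half_sqrt powr_realpow)
    also have "\<dots> = q powr (?n / 2) * det ?S powr (1 / 2)"
      using q dS by (simp add: powr_mult powr_powr)
    finally show ?thesis by (simp add: powr_minus field_simps)
  qed
  finally show "ag_cond_density B C \<mu> \<Sigma> x1 x2 = B / C / sqrt (det T) *
      (1 + quad_inv T (x2 - cond_mean \<mu> \<Sigma> x1)) powr (- real (CARD('m) + CARD('n)) / 2)"
    by (simp add: Q_def)
qed

theorem proposition2:
  fixes B :: real
  assumes "B > 0"
  shows "\<exists>C>0. \<forall>(\<mu> :: real ^ ('m::finite + 'n::finite)) \<Sigma> x1.
           scatter_matrix \<Sigma> \<longrightarrow> x1 \<noteq> subvec Inl \<mu> \<longrightarrow>
           is_mvt_density (real CARD('m)) (cond_mean \<mu> \<Sigma> x1) (cond_scale \<mu> \<Sigma> x1)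
             (ag_cond_density B C \<mu> \<Sigma> x1)"
proof -
  let ?p = "real (CARD('m) + CARD('n))"
  \<comment> \<open>The exponent exceeds the dimension of the second block because the first block
    is nonempty.\<close>
  have "student_mass ?p TYPE(real ^ 'n) < \<infinity>"
    unfolding student_mass_def by (rule nn_integral_student_kernel_finite) simp
  then obtain k where k: "student_mass ?p TYPE(real ^ 'n) = ennreal k" "k \<ge> 0"
    by (cases "student_mass ?p TYPE(real ^ 'n)") auto
  with student_mass_pos[of ?p, where 'a = "real ^ 'n"] have kpos: "k > 0"
    by (cases "k = 0") auto
  show ?thesis
  \<comment> \<open>With \<open>k\<close> the mass of the standard kernel, \<open>B * k\<close>
    depends only on \<open>B\<close> and the dimensions, so it can be chosen before the
    parameters.\<close>
  proof (intro exI[of _ "B * k"] conjI allI impI)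
    show "B * k > 0" using assms kpos by simp
    fix \<mu> :: "real ^ ('m + 'n)" and \<Sigma> :: "real ^ ('m + 'n) ^ ('m + 'n)" and x1
    assume \<Sigma>: "scatter_matrix \<Sigma>" and x1: "x1 \<noteq> subvec Inl \<mu>"
    define T where "T = real CARD('m) *\<^sub>R cond_scale \<mu> \<Sigma> x1"
    let ?a = "cond_mean \<mu> \<Sigma> x1"
    let ?g = "\<lambda>y. (1 + quad_inv T (y - ?a)) powr (- ?p / 2)"
    note eqs = ag_cond_density_eq[OF \<Sigma> x1, folded T_def]
    \<comment> \<open>The prefactor of the kernel: its \<open>1 / sqrt (det T)\<close> will cancel
      the Jacobian, its \<open>1 / k\<close> the mass of the standard kernel.\<close>
    define c where "c = B / (B * k) / sqrt (det T)"
    have dT: "det T > 0" by (rule det_scatter_matrix_pos[OF eqs(1)])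
    have c: "c > 0" using assms kpos dT by (simp add: c_def)
    have f: "ag_cond_density B (B * k) \<mu> \<Sigma> x1 = (\<lambda>y. c * ?g y)"
      by (simp add: fun_eq_iff eqs(2) c_def)
    have "(\<integral>\<^sup>+y. ennreal (c * ?g y) \<partial>lborel) = ennreal c * (\<integral>\<^sup>+y. ennreal (?g y) \<partial>lborel)"
      using c by (simp add: ennreal_mult nn_integral_cmult)
    also have "\<dots> = ennreal (c * (sqrt (det T) * k))"
      unfolding nn_integral_student_kernel[OF eqs(1)] k(1) using c k(2) dT by (simp add: ennreal_mult)
    also have "c * (sqrt (det T) * k) = 1"
      using assms kpos dT by (simp add: c_def)
    finally have "prob_space (density lborel (\<lambda>y. ennreal (c * ?g y)))"
      by (intro prob_spaceI) (simp add: emeasure_density)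
    then show "is_mvt_density (real CARD('m)) ?a (cond_scale \<mu> \<Sigma> x1)
        (ag_cond_density B (B * k) \<mu> \<Sigma> x1)"
      unfolding is_mvt_density_def f using eqs(3,4) c by auto
  qed
qed

end
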